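(* Let $J=\mathbb{Z}$, let $X_1,X_2$ be Hilbert spaces, and let $A_{11}(n)\in\mathcal{L}(X_1)$, $A_{12}(n)\in\mathcal{L}(X_2,X_1)$, $A_{22}(n)\in\mathcal{L}(X_2)$ for $n\in\mathbb{Z}$. Suppose that the block triangular system $$x(n+1)=\begin{pmatrix}A_{11}(n)&A_{12}(n)\\0&A_{22}(n)\end{pmatrix}x(n),\quad n\in\mathbb{Z},$$ on $X_1\times X_2$ admits an exponential dichotomy. Then the block diagonal system $$x(n+1)=\begin{pmatrix}A_{11}(n)&0\\0&A_{22}(n)\end{pmatrix}x(n),\quad n\in\mathbb{Z},$$ admits an exponential dichotomy if and only if the system $x_2(n+1)=A_{22}(n)x_2(n)$, $n\in\mathbb{Z}$, has no nonzero bounded solutions $(x_2(n))_{n\in\mathbb{Z}}\subset X_2$.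
   Context: $\mathcal{L}(X,Y)$ denotes the bounded linear operators $X\to Y$, and $\mathcal{L}(X)=\mathcal{L}(X,X)$. $X_1\times X_2$ carries the norm $\|(x_1,x_2)\|=\max\{\|x_1\|,\|x_2\|\}$ (equivalent to its Hilbert norm). A sequence is bounded if the supremum of the norms of its terms is finite. Exponential dichotomy. Let $X$ be a Banach space and $(A(n))_{n\in\mathbb{Z}}\subset\mathcal{L}(X)$. For $m\ge n$ put $\Phi(m,n)=A(m-1)\cdots A(n)$ if $m>n$ and $\Phi(n,n)=\mathrm{Id}$. The system $x(n+1)=A(n)x(n)$, $n\in\mathbb{Z}$, admits an exponential dichotomy if there exist (bounded) projections $(P(n))_{n\in\mathbb{Z}}\subset\mathcal{L}(X)$ and constants $K,\alpha>0$ such that: (i) for every $n\in\mathbb{Z}$, $A(n)P(n)=P(n+1)A(n)$ and $A(n)|_{\mathcal{N}P(n)}:\mathcal{N}P(n)\to\mathcal{N}P(n+1)$ is invertible, where $\mathcal{N}P(n)$ is the kernel of $P(n)$; (ii) $\|\Phi(m,n)P(n)\|\le Ke^{-\alpha(m-n)}$ for $m\ge n$; (iii) $\|\Phi(m,n)(\mathrm{Id}-P(n))\|\le Ke^{-\alpha(n-m)}$ for $m\le n$, where for $m\le n$, $\Phi(m,n):=(\Phi(n,m)|_{\mathcal{N}P(m)})^{-1}:\mathcal{N}P(n)\to\mathcal{N}P(m)$. *)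

theory Defs
  imports "HOL-Analysis.Analysis"
begin

text \<open>
  Spaces may be real or complex, so the scalar multiplication is a parameter
  \<open>scale :: 'k \<Rightarrow> 'a \<Rightarrow> 'a\<close> over a real normed field \<open>'k\<close> (such as \<open>real\<close> or \<open>complex\<close>)
  that extends the real one. On a type of class \<open>banach\<close> this is a Banach space over \<open>'k\<close>; on a
  type of classes \<open>real_inner\<close> and \<open>banach\<close> it is a Hilbert space over \<open>'k\<close>: for
  \<open>'k = complex\<close> the class provides the real part of the sesquilinear inner product, which
  is recovered by polarization because the norm is homogeneous over \<open>'k\<close>.
\<close>

locale normed_vector_space = vector_space scale
  for scale :: "'k::real_normed_field \<Rightarrow> 'a::real_normed_vector \<Rightarrow> 'a" +
  assumes scale_of_real: "scale (of_real r) x = r *\<^sub>R x"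
    and norm_scale: "norm (scale c x) = norm c * norm x"

definition bounded_ops ::
  "('k::real_normed_field \<Rightarrow> 'a::real_normed_vector \<Rightarrow> 'a) \<Rightarrow>
   ('k \<Rightarrow> 'b::real_normed_vector \<Rightarrow> 'b) \<Rightarrow> ('a \<Rightarrow>\<^sub>L 'b) set" where
  "bounded_ops s1 s2 = {T. Vector_Spaces.linear s1 s2 (blinfun_apply T)}"

lemma normed_vector_space_scaleR:
  "normed_vector_space ((*\<^sub>R) :: real \<Rightarrow> 'a::real_normed_vector \<Rightarrow> 'a)"
  by unfold_locales (simp_all add: algebra_simps)

lemma bounded_ops_scaleR: "bounded_ops (*\<^sub>R) (*\<^sub>R) = UNIV"
  unfolding bounded_ops_def
  using bounded_linear.linear[OF blinfun.bounded_linear_right]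
  by (auto simp: linear_def)

definition op_kernel :: "('a::real_normed_vector \<Rightarrow>\<^sub>L 'b::real_normed_vector) \<Rightarrow> 'a set" where
  "op_kernel T = {x. blinfun_apply T x = 0}"

primrec steps :: "(int \<Rightarrow> 'a::real_normed_vector \<Rightarrow>\<^sub>L 'a) \<Rightarrow> int \<Rightarrow> nat \<Rightarrow> 'a \<Rightarrow>\<^sub>L 'a" where
  "steps A n 0 = id_blinfun"
| "steps A n (Suc k) = A (n + int k) o\<^sub>L steps A n k"

text \<open>\<open>evol A m n\<close> is \<open>A (m - 1) \<circ> \<dots> \<circ> A n\<close>; it is meaningful only for \<open>n \<le> m\<close>.\<close>

definition evol :: "(int \<Rightarrow> 'a::real_normed_vector \<Rightarrow>\<^sub>L 'a) \<Rightarrow> int \<Rightarrow> int \<Rightarrow> 'a \<Rightarrow>\<^sub>L 'a" where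
  "evol A m n = steps A n (nat (m - n))"

text \<open>For \<open>m \<le> n\<close>, the inverse of the restriction of \<open>evol A n m\<close> to the kernel of \<open>P m\<close>.\<close>

definition back_evol ::
  "(int \<Rightarrow> 'a::real_normed_vector \<Rightarrow>\<^sub>L 'a) \<Rightarrow> (int \<Rightarrow> 'a \<Rightarrow>\<^sub>L 'a) \<Rightarrow> int \<Rightarrow> int \<Rightarrow> 'a \<Rightarrow> 'a" where
  "back_evol A P m n = inv_into (op_kernel (P m)) (blinfun_apply (evol A n m))"

text \<open>
  The backward bound, an operator norm estimate, is written pointwise because \<open>back_evol\<close> is
  a plain function, defined on the kernel of \<open>P n\<close> only.
\<close>

definition exponential_dichotomy ::
  "('k::real_normed_field \<Rightarrow> 'a::banach \<Rightarrow> 'a) \<Rightarrow> (int \<Rightarrow> 'a \<Rightarrow>\<^sub>L 'a) \<Rightarrow> bool" where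
  "exponential_dichotomy s A \<longleftrightarrow>
    (\<exists>P K \<alpha>. K > 0 \<and> \<alpha> > 0 \<and>
      (\<forall>n. P n \<in> bounded_ops s s \<and> P n o\<^sub>L P n = P n) \<and>
      (\<forall>n. A n o\<^sub>L P n = P (n + 1) o\<^sub>L A n \<and>
           bij_betw (blinfun_apply (A n)) (op_kernel (P n)) (op_kernel (P (n + 1)))) \<and>
      (\<forall>m n. n \<le> m \<longrightarrow> norm (evol A m n o\<^sub>L P n) \<le> K * exp (- \<alpha> * of_int (m - n))) \<and>
      (\<forall>m n. m \<le> n \<longrightarrow>
        (\<forall>x. norm (back_evol A P m n (x - blinfun_apply (P n) x))
              \<le> K * exp (- \<alpha> * of_int (n - m)) * norm x)))"

lift_definition block_op ::
  "('a::real_normed_vector \<Rightarrow>\<^sub>L 'c::real_normed_vector) \<Rightarrow> ('b::real_normed_vector \<Rightarrow>\<^sub>L 'c) \<Rightarrow>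
   ('a \<Rightarrow>\<^sub>L 'd::real_normed_vector) \<Rightarrow> ('b \<Rightarrow>\<^sub>L 'd) \<Rightarrow> ('a \<times> 'b) \<Rightarrow>\<^sub>L ('c \<times> 'd)"
  is "\<lambda>A B C D x. (A (fst x) + B (snd x), C (fst x) + D (snd x))"
  by (intro bounded_linear_Pair bounded_linear_add)
     (auto intro: bounded_linear_compose bounded_linear_fst bounded_linear_snd)

text \<open>
  The library norm on a product type is the Hilbert norm. It is equivalent to the maximum norm,
  so \<open>exponential_dichotomy\<close> is the same notion for both, up to the constant \<open>K\<close>.
\<close>

lemma norm_prod_equiv_max:
  fixes x :: "'a::real_normed_vector \<times> 'b::real_normed_vector"
  shows "max (norm (fst x)) (norm (snd x)) \<le> norm x"
    and "norm x \<le> 2 * max (norm (fst x)) (norm (snd x))"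
proof -
  show "max (norm (fst x)) (norm (snd x)) \<le> norm x"
    using norm_fst_le[of "fst x" "snd x"] norm_snd_le[of "snd x" "fst x"] by simp
  show "norm x \<le> 2 * max (norm (fst x)) (norm (snd x))"
    using norm_Pair_le[of "fst x" "snd x"] by simp
qed

definition is_solution :: "(int \<Rightarrow> 'a::real_normed_vector \<Rightarrow>\<^sub>L 'a) \<Rightarrow> (int \<Rightarrow> 'a) \<Rightarrow> bool" where
  "is_solution A x \<longleftrightarrow> (\<forall>n. x (n + 1) = blinfun_apply (A n) (x n))"

end

theory Submission
  imports Defs
begin

text \<open>
  An exponential dichotomy is equivalent to admissibility: every bounded forcing \<open>f\<close> has exactly one
  bounded solution of \<open>x (n + 1) = A n (x n) + f (n + 1)\<close>. From a dichotomy, the solution is the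
  Green sum. Conversely the closed graph theorem bounds the solution operator, a weighted estimate
  makes the responses to impulses decay exponentially, and the response to the impulse \<open>v\<close> at time
  \<open>n\<close>, evaluated at \<open>n\<close>, is \<open>P n v\<close>. Admissibility passes from the triangular system to the
  diagonal one: the second component of a solution with forcing \<open>(f, 0)\<close> solves the homogeneous
  \<open>A22\<close> system, so it vanishes and the coupling \<open>A12\<close> drops out.
\<close>

section \<open>The closed graph theorem\<close>

text \<open>By Baire, the closure of some sublevel set of \<open>norm (f x)\<close> has interior, so
  every \<open>x\<close> is approximated within \<open>norm x / 2\<close> by a vector with
  controlled image. Iterating this writes \<open>x\<close> as a series whose images sum absolutely,
  and the closed graph identifies that sum with \<open>f x\<close>.\<close>

theorem closed_graph_bounded_linear:
  fixes f :: "'a::banach \<Rightarrow> 'b::banach"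
  assumes "linear f"
    and closed_graph: "\<And>u x y. \<lbrakk>u \<longlonglongrightarrow> x; (\<lambda>n. f (u n)) \<longlonglongrightarrow> y\<rbrakk> \<Longrightarrow> f x = y"
  shows "bounded_linear f"
proof -
  interpret linear f by fact
  define S where "S k = {x. norm (f x) \<le> real k}" for k
  have "\<exists>k. interior (closure (S k)) \<noteq> {}"
  proof (rule ccontr)
    assume "\<not> ?thesis"
    then have "euclidean interior_of \<Union>(range (\<lambda>k. closure (S k))) = {}"
      by (intro Baire_category_alt) (auto intro: completely_metrizable_space_euclidean)
    moreover have "x \<in> \<Union>(range (\<lambda>k. closure (S k)))" for x
    proof -
      have "x \<in> S (nat \<lceil>norm (f x)\<rceil>)" by (simp add: S_def)
      then show ?thesis using closure_subset by blast
    qed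
    then have "\<Union>(range (\<lambda>k. closure (S k))) = UNIV" by blast
    ultimately show False by (metis empty_not_UNIV interior_of_topspace topspace_euclidean)
  qed
  then obtain k x0 where "x0 \<in> interior (closure (S k))" by blast
  then obtain e where e: "e > 0" "ball x0 e \<subseteq> closure (S k)"
    by (meson mem_interior)
  \<comment> \<open>A difference of two points of \<open>S k\<close> has image of norm at most
    \<open>2 * real k\<close>; dividing by \<open>t = e / 2 / norm x\<close> below gives the factor
    \<open>4 * real k / e\<close>.\<close>
  define C where "C = 4 * real k / e"
  have C: "C \<ge> 0" using e by (simp add: C_def)
  have near: "\<exists>a. norm (f a) \<le> C * norm x \<and> norm (x - a) \<le> norm x / 2" for x
  proof (cases "x = 0")
    case True
    then show ?thesis by (intro exI[of _ 0]) (simp add: zero)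
  next
    case False
    \<comment> \<open>Rescaling \<open>x\<close> to length \<open>e / 2\<close> keeps
      \<open>x0 + t *\<^sub>R x\<close> in the ball. Points of \<open>S k\<close> within
      \<open>d\<close> of it and of \<open>x0\<close> differ by \<open>t *\<^sub>R x\<close> up to
      \<open>2 * d\<close>, so \<open>d\<close> is chosen with
      \<open>2 * d / t = norm x / 2\<close>.\<close>
    define t where "t = e / 2 / norm x"
    have t: "t > 0" using e False by (simp add: t_def)
    define d where "d = t * norm x / 4"
    have d: "d > 0" using t False by (simp add: d_def)
    have "norm (t *\<^sub>R x) < e" using e False by (simp add: t_def)
    then have "x0 + t *\<^sub>R x \<in> closure (S k)" "x0 \<in> closure (S k)"
      using e by (auto simp: dist_norm)
    then obtain a b where ab: "a \<in> S k" "dist a (x0 + t *\<^sub>R x) < d" "b \<in> S k" "dist b x0 < d"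
      using d unfolding closure_approachable by metis
    let ?a = "(a - b) /\<^sub>R t"
    have "norm (f (a - b)) \<le> 2 * real k"
      using ab norm_triangle_ineq4[of "f a" "f b"] by (simp add: S_def diff)
    then have "norm (f ?a) \<le> 2 * real k / t"
      using t by (simp add: scaleR divide_simps)
    also have "\<dots> = C * norm x" using False e by (simp add: C_def t_def field_simps)
    finally have 1: "norm (f ?a) \<le> C * norm x" .
    have "norm (t *\<^sub>R x - (a - b)) \<le> 2 * d"
    proof -
      have "t *\<^sub>R x - (a - b) = (b - x0) - (a - (x0 + t *\<^sub>R x))" by simp
      also have "norm \<dots> \<le> norm (b - x0) + norm (a - (x0 + t *\<^sub>R x))"
        by (rule norm_triangle_ineq4)
      also have "\<dots> \<le> 2 * d" using ab unfolding dist_norm by linarith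
      finally show ?thesis .
    qed
    moreover have "x - ?a = (t *\<^sub>R x - (a - b)) /\<^sub>R t" using t by (simp add: scaleR_diff_right)
    ultimately have "norm (x - ?a) \<le> 2 * d / t"
      using t by (simp add: divide_simps)
    also have "\<dots> = norm x / 2" using t by (simp add: d_def)
    finally show ?thesis using 1 by blast
  qed
  then obtain g where g: "\<And>x. norm (f (g x)) \<le> C * norm x" "\<And>x. norm (x - g x) \<le> norm x / 2"
    by metis
  show ?thesis
  proof (intro bounded_linear_intro[where K = "C * 2"])
    fix x
    \<comment> \<open>The remainder after \<open>n\<close> approximations. It is at least halved
      each time, and the approximants \<open>g (r i)\<close> telescope.\<close>
    define r where "r n = ((\<lambda>x. x - g x) ^^ n) x" for n
    have r: "norm (r n) \<le> norm x * (1/2) ^ n" for n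
    proof (induction n)
      case (Suc n)
      have "norm (r (Suc n)) \<le> norm (r n) / 2" using g(2)[of "r n"] by (simp add: r_def)
      then show ?case using Suc by simp
    qed (simp add: r_def)
    have part: "(\<Sum>i<n. g (r i)) = x - r n" for n
      by (induction n) (auto simp: r_def)
    have "(\<lambda>n. norm x * (1/2) ^ n) \<longlonglongrightarrow> 0"
      by (intro tendsto_mult_right_zero LIMSEQ_power_zero) simp
    then have "r \<longlonglongrightarrow> 0"
      by (rule Lim_null_comparison[OF always_eventually, rule_format, rotated]) (use r in auto)
    then have lim: "(\<lambda>n. \<Sum>i<n. g (r i)) \<longlonglongrightarrow> x"
      unfolding part using tendsto_diff[OF tendsto_const, of r 0] by fastforce
    have bnd: "norm (f (g (r i))) \<le> C * norm x * (1/2) ^ i" for i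
      using g(1)[of "r i"] mult_left_mono[OF r[of i] C] by (simp add: mult.assoc)
    have sums: "(\<lambda>i. C * norm x * (1/2) ^ i) sums (C * norm x * 2)"
      using sums_mult[OF geometric_sums[of "1/2::real"], of "C * norm x"] by simp
    then have "summable (\<lambda>i. norm (f (g (r i))))"
      by (intro summable_comparison_test_ev[OF _ sums_summable[OF sums]]) (use bnd in auto)
    then have "summable (\<lambda>i. f (g (r i)))" by (rule summable_norm_cancel)
    then have "(\<lambda>n. f (\<Sum>i<n. g (r i))) \<longlonglongrightarrow> (\<Sum>i. f (g (r i)))"
      unfolding sum using summable_LIMSEQ by blast
    with lim have "f x = (\<Sum>i. f (g (r i)))" by (rule closed_graph)
    also have "norm \<dots> \<le> (\<Sum>i. C * norm x * (1/2) ^ i)"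
      by (intro norm_suminf_le sums_summable[OF sums] bnd)
    finally show "norm (f x) \<le> norm x * (C * 2)" using sums by (simp add: sums_iff mult_ac)
  qed (simp_all add: add scaleR)
qed

section \<open>Evolution operators and admissibility\<close>

text \<open>The forcing is indexed by its arrival time: an impulse at \<open>n\<close> enters the
  value at \<open>n\<close> itself. This is what makes the response at the impulse time a
  projection.\<close>

definition solves_forced ::
  "(int \<Rightarrow> 'a::real_normed_vector \<Rightarrow>\<^sub>L 'a) \<Rightarrow> (int \<Rightarrow> 'a) \<Rightarrow> (int \<Rightarrow> 'a) \<Rightarrow> bool" where
  "solves_forced A f x \<longleftrightarrow> (\<forall>n. x (n + 1) = blinfun_apply (A n) (x n) + f (n + 1))"

text \<open>Uniqueness is asked of the homogeneous system; by linearity it carries over to every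
  forcing (\<open>admissible_unique\<close>).\<close>

definition admissible :: "(int \<Rightarrow> 'a::real_normed_vector \<Rightarrow>\<^sub>L 'a) \<Rightarrow> bool" where
  "admissible A \<longleftrightarrow>
    (\<forall>f. bounded (range f) \<longrightarrow> (\<exists>x. bounded (range x) \<and> solves_forced A f x)) \<and>
    (\<forall>x. bounded (range x) \<longrightarrow> is_solution A x \<longrightarrow> x = (\<lambda>n. 0))"

lemma solves_forced_diff:
  assumes "solves_forced A f x" "solves_forced A f y"
  shows "is_solution A (\<lambda>n. x n - y n)"
  using assms by (simp add: solves_forced_def is_solution_def blinfun.diff_right)

lemma solves_forced_add:
  assumes "solves_forced A f x" "solves_forced A g y"
  shows "solves_forced A (\<lambda>n. f n + g n) (\<lambda>n. x n + y n)"
  using assms by (simp add: solves_forced_def blinfun.add_right)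

lemma solves_forced_scaleR:
  assumes "solves_forced A f x"
  shows "solves_forced A (\<lambda>n. c *\<^sub>R f n) (\<lambda>n. c *\<^sub>R x n)"
  using assms by (simp add: solves_forced_def blinfun.scaleR_right scaleR_add_right)

lemma bounded_range_iff: "bounded (range x) \<longleftrightarrow> (\<exists>B. \<forall>n. norm (x n) \<le> B)"
  by (auto simp: bounded_iff)

lemma evol_same: "evol A n n = id_blinfun"
  by (simp add: evol_def)

lemma evol_step:
  assumes "n \<le> m"
  shows "evol A (m + 1) n = A m o\<^sub>L evol A m n"
proof -
  have "nat (m + 1 - n) = Suc (nat (m - n))" using assms by simp
  then show ?thesis using assms by (simp add: evol_def)
qed

lemma evol_trajectory:
  assumes "n \<le> m" and "\<And>k. \<lbrakk>n \<le> k; k < m\<rbrakk> \<Longrightarrow> u (k + 1) = blinfun_apply (A k) (u k)"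
  shows "blinfun_apply (evol A m n) (u n) = u m"
  using assms
  by (induction m rule: int_ge_induct) (simp_all add: evol_same evol_step)

lemma evol_commute:
  assumes "n \<le> m" and comm: "\<And>n. A n o\<^sub>L P n = P (n + 1) o\<^sub>L A n"
  shows "blinfun_apply (evol A m n) (blinfun_apply (P n) x) = blinfun_apply (P m) (blinfun_apply (evol A m n) x)"
  using assms(1)
proof (induction m rule: int_ge_induct)
  case base
  show ?case by (simp add: evol_same)
next
  case (step m)
  then show ?case
    using arg_cong[OF comm, of "\<lambda>T. blinfun_apply T (blinfun_apply (evol A m n) x)"]
    by (simp add: evol_step)
qed

lemma evol_bij_betw:
  assumes "n \<le> m"
    and bij: "\<And>n. bij_betw (blinfun_apply (A n)) (op_kernel (P n)) (op_kernel (P (n + 1)))"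
  shows "bij_betw (blinfun_apply (evol A m n)) (op_kernel (P n)) (op_kernel (P m))"
  using assms(1)
proof (induction m rule: int_ge_induct)
  case base
  show ?case by (simp add: evol_same bij_betw_def inj_on_def)
next
  case (step m)
  have "blinfun_apply (evol A (m + 1) n) = blinfun_apply (A m) \<circ> blinfun_apply (evol A m n)"
    using step by (auto simp: evol_step)
  then show ?case by (metis bij_betw_trans step.IH bij)
qed

lemma back_evol_unique:
  assumes "m \<le> n"
    and "\<And>n. bij_betw (blinfun_apply (A n)) (op_kernel (P n)) (op_kernel (P (n + 1)))"
    and "y \<in> op_kernel (P m)" and "blinfun_apply (evol A n m) y = x"
  shows "back_evol A P m n x = y"
  using evol_bij_betw[OF assms(1), of A P] assms(2-4)
  unfolding back_evol_def by (metis bij_betw_inv_into_left)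

lemma back_evol_step:
  assumes "m < n"
    and bij: "\<And>n. bij_betw (blinfun_apply (A n)) (op_kernel (P n)) (op_kernel (P (n + 1)))"
    and x: "x \<in> op_kernel (P n)"
  shows "blinfun_apply (A m) (back_evol A P m n x) = back_evol A P (m + 1) n x"
proof -
  let ?y = "back_evol A P (m + 1) n x"
  have b: "bij_betw (blinfun_apply (evol A n (m + 1))) (op_kernel (P (m + 1))) (op_kernel (P n))"
    by (rule evol_bij_betw) (use assms in auto)
  have y: "?y \<in> op_kernel (P (m + 1))" "blinfun_apply (evol A n (m + 1)) ?y = x"
    using b x unfolding back_evol_def
    by (auto simp: bij_betw_def f_inv_into_f intro!: inv_into_into)
  obtain z where z: "z \<in> op_kernel (P m)" "blinfun_apply (A m) z = ?y"
    using bij[of m] y(1) unfolding bij_betw_def by (metis imageE)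
  \<comment> \<open>The trajectory of \<open>?y\<close> prolonged by one step into the past. It
    reaches \<open>x\<close> at time \<open>n\<close>, so its starting point \<open>z\<close> is the
    pullback of \<open>x\<close> to time \<open>m\<close>.\<close>
  define u where "u k = (if k = m then z else blinfun_apply (evol A k (m + 1)) ?y)" for k
  have "blinfun_apply (evol A n m) (u m) = u n"
  proof (rule evol_trajectory)
    fix k assume k: "m \<le> k" "k < n"
    show "u (k + 1) = blinfun_apply (A k) (u k)"
    proof (cases "k = m")
      case True
      then show ?thesis by (simp add: u_def evol_same z)
    next
      case False
      then show ?thesis using k by (simp add: u_def evol_step)
    qed
  qed (use assms in simp)
  then have "back_evol A P m n x = z"
    using assms by (intro back_evol_unique z) (simp_all add: u_def y)
  then show ?thesis by (simp add: z)
qed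

text \<open>Applied to norms: transport over \<open>j\<close> steps costs a factor \<rho>^j, and
  letting \<open>j\<close> grow makes the parts of a bounded homogeneous solution vanish.\<close>

lemma nonpos_if_le_geometric:
  fixes c L \<rho> :: real
  assumes "\<And>j. c \<le> L * \<rho> ^ j" "0 \<le> \<rho>" "\<rho> < 1"
  shows "c \<le> 0"
proof (rule LIMSEQ_le_const)
  show "(\<lambda>j. L * \<rho> ^ j) \<longlonglongrightarrow> 0"
    using assms(2,3) by (intro tendsto_mult_right_zero LIMSEQ_power_zero) simp
qed (use assms(1) in blast)

section \<open>A dichotomy implies admissibility\<close>

lemma exponential_dichotomyE:
  assumes "exponential_dichotomy s A"
  obtains P K \<alpha> where "K > 0" "\<alpha> > 0"
    and "\<And>n. P n o\<^sub>L P n = P n"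
    and "\<And>n. A n o\<^sub>L P n = P (n + 1) o\<^sub>L A n"
    and "\<And>n. bij_betw (blinfun_apply (A n)) (op_kernel (P n)) (op_kernel (P (n + 1)))"
    and "\<And>m n. n \<le> m \<Longrightarrow> norm (evol A m n o\<^sub>L P n) \<le> K * exp (- \<alpha> * of_int (m - n))"
    and "\<And>m n x. m \<le> n \<Longrightarrow> norm (back_evol A P m n (x - blinfun_apply (P n) x))
              \<le> K * exp (- \<alpha> * of_int (n - m)) * norm x"
  using assms unfolding exponential_dichotomy_def
proof (elim exE conjE, goal_cases)
  case (1 P K \<alpha>)
  show ?case
  proof (rule 1(1)[of K \<alpha> P])
    show "P n o\<^sub>L P n = P n" for n using 1(4) by blast
    show "A n o\<^sub>L P n = P (n + 1) o\<^sub>L A n" for n using 1(5) by blast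
    show "bij_betw (blinfun_apply (A n)) (op_kernel (P n)) (op_kernel (P (n + 1)))" for n
      using 1(5) by blast
  qed (use 1(2,3,6,7) in simp_all)
qed

text \<open>Stable parts of past impulses are carried forward and unstable parts of future ones
  backward, both dominated by geometric series. For a bounded homogeneous solution, the stable part
  comes from the arbitrarily distant past and the unstable part from the arbitrarily distant future,
  so both are zero.\<close>

lemma dichotomy_imp_admissible:
  fixes A :: "int \<Rightarrow> 'a::banach \<Rightarrow>\<^sub>L 'a"
  assumes "exponential_dichotomy s A"
  shows "admissible A"
proof -
  obtain P K \<alpha> where "K > 0" and \<alpha>: "\<alpha> > 0"
    and idem: "\<And>n. P n o\<^sub>L P n = P n"
    and comm: "\<And>n. A n o\<^sub>L P n = P (n + 1) o\<^sub>L A n"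
    and bij: "\<And>n. bij_betw (blinfun_apply (A n)) (op_kernel (P n)) (op_kernel (P (n + 1)))"
    and stable: "\<And>m n. n \<le> m \<Longrightarrow> norm (evol A m n o\<^sub>L P n) \<le> K * exp (- \<alpha> * of_int (m - n))"
    and unstable: "\<And>m n x. m \<le> n \<Longrightarrow> norm (back_evol A P m n (x - blinfun_apply (P n) x))
              \<le> K * exp (- \<alpha> * of_int (n - m)) * norm x"
    using exponential_dichotomyE[OF assms] by metis
  define \<rho> where "\<rho> = exp (- \<alpha>)"
  have \<rho>: "0 < \<rho>" "\<rho> < 1" using \<alpha> by (simp_all add: \<rho>_def)
  have pow: "exp (- \<alpha> * of_int (int j)) = \<rho> ^ j" for j
    by (simp add: \<rho>_def exp_of_nat_mult[symmetric] mult.commute)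
  have stable': "norm (blinfun_apply (evol A n (n - int j)) (blinfun_apply (P (n - int j)) x))
      \<le> K * M * \<rho> ^ j" if "norm x \<le> M" for n j x M
  proof -
    have "norm (blinfun_apply (evol A n (n - int j) o\<^sub>L P (n - int j)) x)
        \<le> norm (evol A n (n - int j) o\<^sub>L P (n - int j)) * norm x"
      by (rule norm_blinfun)
    also have "\<dots> \<le> (K * exp (- \<alpha> * of_int (int j))) * M"
      using stable[of "n - int j" n] \<open>K > 0\<close> that by (intro mult_mono) auto
    finally show ?thesis unfolding pow by (simp add: mult_ac)
  qed
  have unstable': "norm (back_evol A P n (n + int j) (x - blinfun_apply (P (n + int j)) x))
      \<le> K * M * \<rho> ^ j" if "norm x \<le> M" for n j x M
  proof -
    have "norm (back_evol A P n (n + int j) (x - blinfun_apply (P (n + int j)) x))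
        \<le> K * exp (- \<alpha> * of_int (int j)) * norm x"
      using unstable[of n "n + int j" x] by simp
    also have "\<dots> \<le> K * exp (- \<alpha> * of_int (int j)) * M"
      using \<open>K > 0\<close> that by (intro mult_left_mono) auto
    finally show ?thesis unfolding pow by (simp add: mult_ac)
  qed
  have ker: "x - blinfun_apply (P n) x \<in> op_kernel (P n)" for n x
    using idem[of n] by (simp add: op_kernel_def blinfun.diff_right flip: blinfun_apply_blinfun_compose)
  have exist: "\<exists>x. bounded (range x) \<and> solves_forced A f x" if fb: "bounded (range f)" for f
  proof -
    obtain M where M: "\<And>n. norm (f n) \<le> M" using fb unfolding bounded_range_iff by blast
    have "M \<ge> 0" using norm_ge_zero[of "f 0"] M[of 0] by linarith
    \<comment> \<open>\<open>a n j\<close> is the contribution at time \<open>n\<close> of the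
      impulse at \<open>n - j\<close>, and \<open>b n j\<close> that of the impulse at
      \<open>n + j + 1\<close>. The shift in \<open>b\<close> means that the impulse at time
      \<open>n\<close> itself contributes only its stable part.\<close>
    define a where "a n j = blinfun_apply (evol A n (n - int j)) (blinfun_apply (P (n - int j)) (f (n - int j)))"
      for n j
    define Q where "Q n = f n - blinfun_apply (P n) (f n)" for n
    define b where "b n j = back_evol A P n (n + int (Suc j)) (Q (n + int (Suc j)))" for n j
    have a: "norm (a n j) \<le> K * M * \<rho> ^ j" for n j
      unfolding a_def by (rule stable'[OF M])
    have b: "norm (b n j) \<le> K * M * \<rho> ^ j" for n j
    proof -
      have "norm (b n j) \<le> K * M * \<rho> ^ Suc j"
        unfolding b_def Q_def by (rule unstable'[OF M])
      also have "\<dots> \<le> K * M * \<rho> ^ j"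
        using \<rho> \<open>K > 0\<close> \<open>M \<ge> 0\<close> by (intro mult_left_mono power_decreasing) auto
      finally show ?thesis .
    qed
    have geo: "(\<lambda>j. K * M * \<rho> ^ j) sums (K * M * (1 / (1 - \<rho>)))"
      using \<rho> by (intro sums_mult geometric_sums) simp
    have suma: "summable (a n)" for n
      by (rule summable_comparison_test'[OF sums_summable[OF geo]]) (rule a)
    have sumb: "summable (b n)" for n
      by (rule summable_comparison_test'[OF sums_summable[OF geo]]) (rule b)
    define x where "x n = suminf (a n) - suminf (b n)" for n
    have "norm (x n) \<le> K * M * (1 / (1 - \<rho>)) + K * M * (1 / (1 - \<rho>))" for n
    proof -
      have "norm (suminf (a n)) \<le> (\<Sum>j. K * M * \<rho> ^ j)" "norm (suminf (b n)) \<le> (\<Sum>j. K * M * \<rho> ^ j)"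
        by (intro norm_suminf_le sums_summable[OF geo] a b)+
      then show ?thesis unfolding x_def using geo norm_triangle_ineq4[of "suminf (a n)" "suminf (b n)"]
        by (simp add: sums_iff)
    qed
    then have "bounded (range x)" by (auto simp: bounded_range_iff)
    moreover have "x (n + 1) = blinfun_apply (A n) (x n) + f (n + 1)" for n
    proof -
      \<comment> \<open>One time step shifts both series: \<open>a\<close> gains the stable part of
        \<open>f (n + 1)\<close> as a new head, and \<open>b\<close> loses its head, the unstable
        part. With the minus sign in \<open>x\<close>, the two add up to
        \<open>f (n + 1)\<close>.\<close>
      have "a (n + 1) (Suc j) = blinfun_apply (A n) (a n j)" for j
        by (simp add: a_def evol_step)
      then have "suminf (a (n + 1)) = blinfun_apply (A n) (suminf (a n)) + a (n + 1) 0"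
        using suminf_split_head[OF suma[of "n + 1"]]
        by (simp add: bounded_linear.suminf[OF blinfun.bounded_linear_right suma])
      moreover have "a (n + 1) 0 = f (n + 1) - Q (n + 1)"
        by (simp add: a_def Q_def evol_same)
      moreover have step: "blinfun_apply (A n) (b n j) = back_evol A P (n + 1) (n + int (Suc j)) (Q (n + int (Suc j)))" for j
        unfolding b_def by (rule back_evol_step) (use bij ker in \<open>auto simp: Q_def\<close>)
      have "blinfun_apply (A n) (b n (Suc j)) = b (n + 1) j" for j
        using step[of "Suc j"] unfolding b_def by (simp add: algebra_simps)
      then have "suminf (b (n + 1)) = blinfun_apply (A n) (suminf (b n)) - blinfun_apply (A n) (b n 0)"
        using suminf_split_head[OF bounded_linear.summable[OF blinfun.bounded_linear_right sumb[of n], of "A n"]]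
        by (simp add: bounded_linear.suminf[OF blinfun.bounded_linear_right sumb])
      moreover have "blinfun_apply (A n) (b n 0) = Q (n + 1)"
        unfolding step
        by (rule back_evol_unique) (use bij ker in \<open>auto simp: Q_def evol_same\<close>)
      ultimately show ?thesis by (simp add: x_def blinfun.diff_right)
    qed
    ultimately show ?thesis by (auto simp: solves_forced_def)
  qed
  have unique: "z = (\<lambda>n. 0)" if zb: "bounded (range z)" and sol: "is_solution A z" for z
  proof
    fix n
    obtain M where M: "\<And>n. norm (z n) \<le> M" using zb unfolding bounded_range_iff by blast
    have evol: "blinfun_apply (evol A m n) (z n) = z m" if "n \<le> m" for m n
      using that sol by (intro evol_trajectory) (auto simp: is_solution_def)
    have Pz: "blinfun_apply (P n) (z n) = 0" for n
    proof -
      have "norm (blinfun_apply (P n) (z n)) \<le> K * M * \<rho> ^ j" for j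
      proof -
        have "blinfun_apply (P n) (z n) = blinfun_apply (P n o\<^sub>L evol A n (n - int j)) (z (n - int j))"
          by (simp add: evol)
        also have "\<dots> = blinfun_apply (evol A n (n - int j)) (blinfun_apply (P (n - int j)) (z (n - int j)))"
          using evol_commute[of "n - int j" n A P] comm by simp
        also have "norm \<dots> \<le> K * M * \<rho> ^ j" by (rule stable'[OF M])
        finally show ?thesis .
      qed
      then show ?thesis using nonpos_if_le_geometric[of _ "K * M" \<rho>] \<rho> by fastforce
    qed
    have "norm (z n) \<le> K * M * \<rho> ^ j" for j
    proof -
      \<comment> \<open>Since \<open>P\<close> annihilates the solution, its value at
        \<open>n\<close> is the pullback of its value at \<open>n + j\<close>.\<close>
      have "back_evol A P n (n + int j) (z (n + int j)) = z n"
        by (rule back_evol_unique) (use bij Pz evol in \<open>auto simp: op_kernel_def\<close>)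
      then show ?thesis using unstable'[OF M, of n j "n + int j"] Pz by simp
    qed
    then show "z n = 0" using nonpos_if_le_geometric[of _ "K * M" \<rho>] \<rho> by fastforce
  qed
  show ?thesis using exist unique by (auto simp: admissible_def)
qed

section \<open>From admissibility to a dichotomy\<close>

lemma admissible_unique:
  assumes "admissible A" "bounded (range x)" "bounded (range y)"
    and "solves_forced A f x" "solves_forced A f y"
  shows "x = y"
proof -
  have "is_solution A (\<lambda>n. x n - y n)"
    using assms by (intro solves_forced_diff)
  moreover have "bounded (range (\<lambda>n. x n - y n))"
    using assms by (intro bounded_minus_comp)
  ultimately have "(\<lambda>n. x n - y n) = (\<lambda>n. 0)"
    using assms(1) unfolding admissible_def by blast
  then show ?thesis by (simp add: fun_eq_iff)
qed

section \<open>Boundedness of the solution operator and decay of impulse responses\<close>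

definition response_bound :: "(int \<Rightarrow> 'a::real_normed_vector \<Rightarrow>\<^sub>L 'a) \<Rightarrow> real \<Rightarrow> bool" where
  "response_bound A C \<longleftrightarrow>
    (\<forall>f x b. bounded (range x) \<longrightarrow> solves_forced A f x \<longrightarrow> (\<forall>m. norm (f m) \<le> b) \<longrightarrow>
      (\<forall>m. norm (x m) \<le> C * b))"

text \<open>The library has completeness only over metric domains, and \<open>int\<close> is not one.\<close>

instance bcontfun :: (topological_space, complete_space) complete_space
proof
  fix f :: "nat \<Rightarrow> ('a, 'b) bcontfun"
  assume "Cauchy f"
  then have "uniformly_Cauchy_on UNIV (\<lambda>n. apply_bcontfun (f n))"
    unfolding Cauchy_def uniformly_Cauchy_on_def by (meson dist_fun_lt_imp_dist_val_lt)
  then obtain g where "uniform_limit UNIV (\<lambda>n. apply_bcontfun (f n)) g sequentially"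
    using Cauchy_uniformly_convergent unfolding uniformly_convergent_on_def by blast
  then show "convergent f"
    by (rule uniform_limit_bcontfunE) (auto intro: convergentI)
qed

instance bcontfun :: (topological_space, banach) banach ..

text \<open>Bounded sequences form a Banach space, here the bounded continuous functions on the
  discrete space \<open>int\<close>. The solution operator has closed graph because the equation at
  each time involves finitely many values and so survives pointwise limits.\<close>

lemma admissible_bound:
  fixes A :: "int \<Rightarrow> 'a::banach \<Rightarrow>\<^sub>L 'a"
  assumes adm: "admissible A"
  shows "\<exists>C>0. response_bound A C"
proof -
  have bcont: "apply_bcontfun (Bcontfun x) = x" if "bounded (range x)" for x :: "int \<Rightarrow> 'a"
    using that by (intro Bcontfun_inverse) (simp add: bcontfun_def)
  define S :: "(int \<Rightarrow>\<^sub>C 'a) \<Rightarrow> (int \<Rightarrow>\<^sub>C 'a)"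
    where "S f = (SOME x. solves_forced A f (apply_bcontfun x))" for f
  have S: "solves_forced A f (S f)" for f :: "int \<Rightarrow>\<^sub>C 'a"
  proof -
    obtain x where "bounded (range x)" "solves_forced A f x"
      using adm bounded_apply_bcontfun[of f] unfolding admissible_def by blast
    then have "solves_forced A f (Bcontfun x)" by (simp add: bcont)
    then show ?thesis unfolding S_def by (rule someI)
  qed
  have eqI: "S f = x" if "solves_forced A f x" for f x :: "int \<Rightarrow>\<^sub>C 'a"
    using admissible_unique[OF adm _ _ S[of f] that] by (simp add: apply_bcontfun_inject)
  have "bounded_linear S"
  proof (rule closed_graph_bounded_linear)
    show "linear S"
    proof (rule linearI)
      fix f g :: "int \<Rightarrow>\<^sub>C 'a" and c :: real
      show "S (f + g) = S f + S g"
        using solves_forced_add[OF S S, of f g] by (intro eqI) simp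
      show "S (c *\<^sub>R f) = c *\<^sub>R S f"
        using solves_forced_scaleR[OF S, of c f] by (intro eqI) simp
    qed
    fix u :: "nat \<Rightarrow> int \<Rightarrow>\<^sub>C 'a" and f x
    assume u: "u \<longlonglongrightarrow> f" and Su: "(\<lambda>k. S (u k)) \<longlonglongrightarrow> x"
    have lim: "(\<lambda>k. apply_bcontfun (v k) n) \<longlonglongrightarrow> y n" if "v \<longlonglongrightarrow> y"
      for v and y :: "int \<Rightarrow>\<^sub>C 'a" and n
      using tendsto_uniform_limitI[OF tendsto_bcontfun_uniform_limit[OF that]] by simp
    show "S f = x"
    proof (rule eqI, unfold solves_forced_def, rule)
      fix n
      have "(\<lambda>k. blinfun_apply (A n) (S (u k) n) + u k (n + 1))
          \<longlonglongrightarrow> blinfun_apply (A n) (x n) + f (n + 1)"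
        by (intro tendsto_intros lim u Su)
      then have "(\<lambda>k. S (u k) (n + 1)) \<longlonglongrightarrow> blinfun_apply (A n) (x n) + f (n + 1)"
        using S by (simp add: solves_forced_def)
      then show "x (n + 1) = blinfun_apply (A n) (x n) + f (n + 1)"
        using lim[OF Su] LIMSEQ_unique by blast
    qed
  qed
  then obtain C where C: "C > 0" "\<And>f. norm (S f) \<le> norm f * C"
    using bounded_linear.pos_bounded by blast
  have "response_bound A C"
    unfolding response_bound_def
  proof (intro allI impI)
    fix f x :: "int \<Rightarrow> 'a" and b m
    assume x: "bounded (range x)" and sol: "solves_forced A f x" and b: "\<forall>m. norm (f m) \<le> b"
    then have "bounded (range f)" unfolding bounded_range_iff by blast
    note f = bcont[OF this] and x = bcont[OF x]
    have "S (Bcontfun f) = Bcontfun x" using sol by (intro eqI) (simp add: f x)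
    then have "norm (x m) \<le> norm (Bcontfun f) * C"
      using norm_bounded[of "Bcontfun x" m] C(2)[of "Bcontfun f"] by (simp add: x)
    also have "\<dots> \<le> b * C"
      using C(1) norm_bound[of "Bcontfun f" b] b f by (intro mult_right_mono) auto
    finally show "norm (x m) \<le> C * b" by (simp add: mult.commute)
  qed
  with C(1) show ?thesis by blast
qed

text \<open>Multiplying a solution by the weight \<open>r ^ min \<bar>m - n\<bar> N\<close>, truncated so that boundedness is
  preserved, gives a solution for a forcing that differs by at most \<open>r - 1\<close> times the weighted
  solution; for \<open>C * (r - 1) = 1/2\<close> this term is absorbed. The coefficients need no uniform bound
  because \<open>A (m - 1) (x (m - 1))\<close> equals \<open>x m\<close> up to the forcing.\<close>

lemma impulse_response_decay:
  fixes A :: "int \<Rightarrow> 'a::banach \<Rightarrow>\<^sub>L 'a"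
  assumes C: "C > 0"
    and bound: "response_bound A C"
    and r: "r = 1 + 1 / (2 * C)"
    and x: "bounded (range x)" "solves_forced A (\<lambda>k. if k = n then v else 0) x"
  shows "norm (x m) * r ^ nat \<bar>m - n\<bar> \<le> 2 * C * r * norm v"
proof -
  have r1: "r > 1" using C r by simp
  \<comment> \<open>Truncating at the distance from \<open>n\<close> to \<open>m\<close> leaves the
    weight at \<open>m\<close> intact.\<close>
  define N where "N = nat \<bar>m - n\<bar>"
  define e where "e k = min (nat \<bar>k - n\<bar>) N" for k
  define w where "w k = r ^ e k" for k
  have w_pos: "w k > 0" for k using r1 by (simp add: w_def)
  have w_le: "w k \<le> r ^ N" for k using r1 by (simp add: w_def e_def power_increasing)
  define y where "y k = w k *\<^sub>R x k" for k
  obtain M where M: "\<And>k. norm (x k) \<le> M" using x(1) unfolding bounded_range_iff by blast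
  have "norm (y k) \<le> r ^ N * M" for k
    using w_le[of k] w_pos[of k] M[of k] r1 by (auto simp: y_def intro!: mult_mono)
  then have y_bdd: "bounded (range y)" by (auto simp: bounded_range_iff)
  define B where "B = (SUP k. norm (y k))"
  have B: "norm (y k) \<le> B" for k
    unfolding B_def using bounded_norm_comp[of y UNIV] y_bdd
    by (intro cSUP_upper bounded_imp_bdd_above) simp_all
  have w_diff: "\<bar>w k - w (k - 1)\<bar> \<le> (r - 1) * w k" for k
  proof -
    have "nat \<bar>k - 1 - n\<bar> = Suc (nat \<bar>k - n\<bar>) \<or> nat \<bar>k - n\<bar> = Suc (nat \<bar>k - 1 - n\<bar>)"
      by linarith
    then have "e (k - 1) = e k \<or> e (k - 1) = Suc (e k) \<or> e k = Suc (e (k - 1))"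
      unfolding e_def by linarith
    then consider "e (k - 1) = e k" | "e (k - 1) = Suc (e k)" | "e k = Suc (e (k - 1))" by blast
    then show ?thesis
    proof cases
      case 1
      then show ?thesis using r1 w_pos[of k] by (simp add: w_def)
    next
      case 2
      then have "w (k - 1) - w k = (r - 1) * w k" by (simp add: w_def algebra_simps)
      then show ?thesis using r1 w_pos[of k] by (simp add: abs_if algebra_simps)
    next
      case 3
      then have *: "w k - w (k - 1) = (r - 1) * w (k - 1)" "w k = r * w (k - 1)"
        by (simp_all add: w_def algebra_simps)
      then have "w (k - 1) \<le> w k" using r1 w_pos[of "k - 1"] by simp
      then show ?thesis using * r1 by (simp add: mult_left_mono)
    qed
  qed
  \<comment> \<open>The discrete product rule: \<open>A (k - 1)\<close> sends
    \<open>y (k - 1)\<close> to \<open>w (k - 1)\<close> times the difference of \<open>x k\<close>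
    and the impulse, and \<open>h k\<close> is what remains of \<open>y k\<close>.\<close>
  define h where "h k = (w k - w (k - 1)) *\<^sub>R x k + w (k - 1) *\<^sub>R (if k = n then v else 0)" for k
  have "solves_forced A h y"
    using x(2)
    by (simp add: solves_forced_def h_def y_def blinfun.scaleR_right algebra_simps)
  moreover have "norm (h k) \<le> (r - 1) * B + r * norm v" for k
  proof -
    have "norm ((w k - w (k - 1)) *\<^sub>R x k) \<le> (r - 1) * w k * norm (x k)"
      using w_diff[of k] by (simp add: mult_right_mono)
    also have "\<dots> = (r - 1) * norm (y k)" using w_pos[of k] by (simp add: y_def)
    also have "\<dots> \<le> (r - 1) * B" using B[of k] r1 by (intro mult_left_mono) auto
    finally have 1: "norm ((w k - w (k - 1)) *\<^sub>R x k) \<le> (r - 1) * B" .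
    \<comment> \<open>The impulse is weighted by \<open>w\<close> one step before \<open>n\<close>,
      where the exponent is at most 1.\<close>
    have "w (n - 1) \<le> r" using r1 by (cases "N = 0") (auto simp: w_def e_def min_def)
    then have "norm (w (k - 1) *\<^sub>R (if k = n then v else 0)) \<le> r * norm v"
      using w_pos[of "n - 1"] r1 by (auto intro: mult_right_mono)
    with 1 show ?thesis unfolding h_def using norm_triangle_mono by blast
  qed
  ultimately have "norm (y k) \<le> C * ((r - 1) * B + r * norm v)" for k
    using bound y_bdd unfolding response_bound_def by blast
  then have "B \<le> C * ((r - 1) * B + r * norm v)"
    unfolding B_def by (intro cSUP_least) auto
  also have "\<dots> = B / 2 + C * r * norm v" using C by (simp add: r field_simps)
  finally have "B \<le> 2 * C * r * norm v" by simp
  moreover have "norm (y m) = norm (x m) * r ^ nat \<bar>m - n\<bar>"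
    using r1 by (simp add: y_def w_def e_def N_def)
  ultimately show ?thesis using B[of m] by simp
qed

section \<open>The Green function of an admissible system and its projections\<close>

locale admissible_system =
  fixes A :: "int \<Rightarrow> 'a::banach \<Rightarrow>\<^sub>L 'a"
  assumes adm: "admissible A"
begin

definition green :: "int \<Rightarrow> 'a \<Rightarrow> int \<Rightarrow> 'a" where
  "green n v = (THE x. bounded (range x) \<and> solves_forced A (\<lambda>k. if k = n then v else 0) x)"

lemma green: "bounded (range (green n v))" "solves_forced A (\<lambda>k. if k = n then v else 0) (green n v)"
proof -
  have "bounded (range (\<lambda>k. if k = n then v else 0))"
    unfolding bounded_range_iff by (rule exI[of _ "norm v"]) auto
  then have "\<exists>x. bounded (range x) \<and> solves_forced A (\<lambda>k. if k = n then v else 0) x"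
    using adm unfolding admissible_def by blast
  then have "\<exists>!x. bounded (range x) \<and> solves_forced A (\<lambda>k. if k = n then v else 0) x"
    using admissible_unique[OF adm] by blast
  from theI'[OF this] show "bounded (range (green n v))"
    "solves_forced A (\<lambda>k. if k = n then v else 0) (green n v)"
    unfolding green_def by auto
qed

lemma green_step:
  "green n v (k + 1) = blinfun_apply (A k) (green n v k) + (if k + 1 = n then v else 0)"
  using green(2) unfolding solves_forced_def by blast

lemma green_eqI:
  assumes "bounded (range x)" "solves_forced A (\<lambda>k. if k = n then v else 0) x"
  shows "green n v = x"
  by (rule admissible_unique[OF adm green(1) assms(1) green(2) assms(2)])

lemma green_add: "green n (v + w) = (\<lambda>m. green n v m + green n w m)"
proof (rule green_eqI)
  show "bounded (range (\<lambda>m. green n v m + green n w m))"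
    by (intro bounded_plus_comp green)
  have "(\<lambda>k. if k = n then v + w else 0) = (\<lambda>k. (if k = n then v else 0) + (if k = n then w else 0))"
    by auto
  then show "solves_forced A (\<lambda>k. if k = n then v + w else 0) (\<lambda>m. green n v m + green n w m)"
    using solves_forced_add[OF green(2) green(2), of n v n w] by simp
qed

lemma green_scale:
  assumes "normed_vector_space s" and "\<And>k x. blinfun_apply (A k) (s c x) = s c (blinfun_apply (A k) x)"
  shows "green n (s c v) = (\<lambda>m. s c (green n v m))"
proof (rule green_eqI)
  interpret normed_vector_space s by fact
  obtain M where "\<And>m. norm (green n v m) \<le> M" using green(1) unfolding bounded_range_iff by blast
  then have "norm (s c (green n v m)) \<le> norm c * M" for m
    by (simp add: norm_scale mult_left_mono)
  then show "bounded (range (\<lambda>m. s c (green n v m)))" unfolding bounded_range_iff by blast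
  show "solves_forced A (\<lambda>k. if k = n then s c v else 0) (\<lambda>m. s c (green n v m))"
    using assms(2) by (auto simp: solves_forced_def green_step scale_right_distrib)
qed

text \<open>A vector with a bounded forward (backward) trajectory is fixed (annihilated) by
  \<open>\<lambda>v. green n v n\<close>, which is therefore the dichotomy projection at time \<open>n\<close>.\<close>

lemma green_forward:
  assumes "\<And>m. n \<le> m \<Longrightarrow> u (m + 1) = blinfun_apply (A m) (u m)"
    and "\<And>m. n \<le> m \<Longrightarrow> norm (u m) \<le> M"
  shows "green n (u n) = (\<lambda>m. if n \<le> m then u m else 0)"
proof (rule green_eqI)
  have "0 \<le> M" using assms(2)[of n] norm_ge_zero[of "u n"] by linarith
  then show "bounded (range (\<lambda>m. if n \<le> m then u m else 0))"
    unfolding bounded_range_iff using assms(2) by (intro exI[of _ M]) auto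
  show "solves_forced A (\<lambda>k. if k = n then u n else 0) (\<lambda>m. if n \<le> m then u m else 0)"
    using assms(1) by (auto simp: solves_forced_def)
qed

lemma green_backward:
  assumes "\<And>m. m < n \<Longrightarrow> u (m + 1) = blinfun_apply (A m) (u m)"
    and "\<And>m. m \<le> n \<Longrightarrow> norm (u m) \<le> M"
  shows "green n (u n) = (\<lambda>m. if m < n then - u m else 0)"
proof (rule green_eqI)
  have "0 \<le> M" using assms(2)[of n] norm_ge_zero[of "u n"] by linarith
  then show "bounded (range (\<lambda>m. if m < n then - u m else 0))"
    unfolding bounded_range_iff using assms(2) by (intro exI[of _ M]) auto
  \<comment> \<open>At time \<open>n\<close> the impulse \<open>u n\<close> cancels the image of
    \<open>- u (n - 1)\<close>, so the response is zero from then on.\<close>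
  have "u n = blinfun_apply (A (n - 1)) (u (n - 1))" using assms(1)[of "n - 1"] by simp
  moreover have "m + 1 = n \<longleftrightarrow> m = n - 1" for m by auto
  ultimately show "solves_forced A (\<lambda>k. if k = n then u n else 0) (\<lambda>m. if m < n then - u m else 0)"
    using assms(1) by (auto simp: solves_forced_def blinfun.minus_right)
qed

definition proj :: "int \<Rightarrow> 'a \<Rightarrow>\<^sub>L 'a" where
  "proj n = Blinfun (\<lambda>v. green n v n)"

lemma green_scaleR: "green n (c *\<^sub>R v) = (\<lambda>m. c *\<^sub>R green n v m)"
  by (rule green_scale[OF normed_vector_space_scaleR]) (simp add: blinfun.scaleR_right)

lemma green_decay:
  obtains C r where "C > 0" "r > 1"
    and "\<forall>n v m. norm (green n v m) * r ^ nat \<bar>m - n\<bar> \<le> C * norm v"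
proof -
  obtain C where C: "C > 0" "response_bound A C"
    using admissible_bound[OF adm] by blast
  define r where "r = 1 + 1 / (2 * C)"
  have "r > 1" using C by (simp add: r_def)
  show thesis
  proof (rule that)
    show "\<forall>n v m. norm (green n v m) * r ^ nat \<bar>m - n\<bar> \<le> 2 * C * r * norm v"
      using impulse_response_decay[OF C r_def green] by blast
  qed (use C \<open>r > 1\<close> in simp_all)
qed

text \<open>\<open>Blinfun\<close> needs a bounded linear map. Boundedness is the decay estimate at
  \<open>m = n\<close>, where the weight is 1.\<close>

lemma proj_apply: "blinfun_apply (proj n) v = green n v n"
proof -
  obtain C r where decay: "\<forall>n v m. norm (green n v m) * r ^ nat \<bar>m - n\<bar> \<le> C * norm v"
    by (rule green_decay)
  have "bounded_linear (\<lambda>v. green n v n)"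
  proof (rule bounded_linear_intro)
    show "norm (green n v n) \<le> norm v * C" for v
      using decay[rule_format, of n v n] by (simp add: mult.commute)
    show "green n (v + w) n = green n v n + green n w n" for v w
      by (simp only: green_add)
    show "green n (c *\<^sub>R v) n = c *\<^sub>R green n v n" for c v
      by (simp only: green_scaleR)
  qed
  then show ?thesis by (simp add: proj_def bounded_linear_Blinfun_apply)
qed

section \<open>Invariance of the ranges and kernels of the projections\<close>

lemma proj_forward:
  assumes "\<And>m. n \<le> m \<Longrightarrow> u (m + 1) = blinfun_apply (A m) (u m)"
    and "\<And>m. n \<le> m \<Longrightarrow> norm (u m) \<le> M"
  shows "blinfun_apply (proj n) (u n) = u n"
  using green_forward[of n u M] assms by (simp add: proj_apply)

lemma proj_backward:
  assumes "\<And>m. m < n \<Longrightarrow> u (m + 1) = blinfun_apply (A m) (u m)"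
    and "\<And>m. m \<le> n \<Longrightarrow> norm (u m) \<le> M"
  shows "blinfun_apply (proj n) (u n) = 0"
  using green_backward[of n u M] assms by (simp add: proj_apply)

text \<open>The backward trajectory through \<open>v - green n v n\<close>. Before \<open>n\<close>
  the response solves the homogeneous equation; the impulse makes it jump by \<open>v\<close> at
  \<open>n\<close>, so its negative continues to \<open>v - green n v n\<close>.\<close>

definition backward :: "int \<Rightarrow> 'a \<Rightarrow> int \<Rightarrow> 'a" where
  "backward n v m = (if m = n then v - green n v n else - green n v m)"

lemma backward_step:
  assumes "m < n"
  shows "backward n v (m + 1) = blinfun_apply (A m) (backward n v m)"
  using assms green_step[of n v m] by (auto simp: backward_def blinfun.minus_right)

lemma green_bounded: "\<exists>M. \<forall>m. norm (green n v m) \<le> M"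
  using green(1)[of n v] unfolding bounded_range_iff by blast

lemma backward_bounded: "\<exists>M. \<forall>m. norm (backward n v m) \<le> M"
proof -
  obtain M where M: "\<And>m. norm (green n v m) \<le> M" using green_bounded by blast
  have "norm (backward n v m) \<le> norm v + M" for m
    using M[of m] norm_triangle_ineq4[of v "green n v n"] norm_ge_zero[of v]
    unfolding backward_def by (auto simp del: norm_ge_zero)
  then show ?thesis by blast
qed

lemma backward_in_kernel:
  assumes "m \<le> n"
  shows "backward n v m \<in> op_kernel (proj m)"
proof -
  obtain M where "\<And>m. norm (backward n v m) \<le> M" using backward_bounded by blast
  then show ?thesis
    unfolding op_kernel_def using assms
    by (auto intro!: proj_backward[of _ "backward n v"] backward_step)
qed

lemma kernel_backward: "v \<in> op_kernel (proj n) \<Longrightarrow> backward n v n = v"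
  by (simp add: op_kernel_def proj_apply backward_def)

lemma proj_idem: "blinfun_apply (proj n) (green n v n) = green n v n"
proof -
  obtain M where "\<And>m. norm (green n v m) \<le> M" using green_bounded by blast
  then show ?thesis by (intro proj_forward[of n "green n v"]) (simp_all add: green_step)
qed

lemma step_kernel:
  assumes "v \<in> op_kernel (proj n)"
  shows "blinfun_apply (A n) v \<in> op_kernel (proj (n + 1))"
proof -
  obtain M where M: "\<And>m. norm (backward n v m) \<le> M" using backward_bounded by blast
  \<comment> \<open>The backward trajectory of \<open>v\<close>, extended by one step so that it
    ends at the image of \<open>v\<close>.\<close>
  define u where "u m = (if m \<le> n then backward n v m else blinfun_apply (A n) v)" for m
  have "norm (u m) \<le> M + norm (blinfun_apply (A n) v)" for m
    using M[of m] order_trans[OF norm_ge_zero M[of m]] by (auto simp: u_def intro: add_increasing2)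
  moreover have "u (m + 1) = blinfun_apply (A m) (u m)" if "m < n + 1" for m
    using that assms by (cases "m = n") (auto simp: u_def backward_step kernel_backward)
  ultimately have "blinfun_apply (proj (n + 1)) (u (n + 1)) = 0"
    by (intro proj_backward[of _ u]) auto
  then show ?thesis by (simp add: u_def op_kernel_def)
qed

lemma step_range:
  assumes "blinfun_apply (proj n) v = v"
  shows "blinfun_apply (proj (n + 1)) (blinfun_apply (A n) v) = blinfun_apply (A n) v"
proof -
  obtain M where "\<And>m. norm (green n v m) \<le> M" using green_bounded by blast
  then have "blinfun_apply (proj (n + 1)) (green n v (n + 1)) = green n v (n + 1)"
    by (intro proj_forward) (auto simp: green_step)
  moreover have "green n v (n + 1) = blinfun_apply (A n) v"
    using assms by (simp add: green_step proj_apply)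
  ultimately show ?thesis by simp
qed

text \<open>Split \<open>v\<close> into \<open>green n v n\<close>, fixed by \<open>proj n\<close>,
  and a remainder in its kernel: \<open>A n\<close> maps fixed vectors to fixed vectors and kernel
  to kernel.\<close>

lemma proj_commute: "A n o\<^sub>L proj n = proj (n + 1) o\<^sub>L A n"
proof (rule blinfun_eqI)
  fix v
  have 1: "blinfun_apply (proj (n + 1)) (blinfun_apply (A n) (green n v n)) = blinfun_apply (A n) (green n v n)"
    by (intro step_range proj_idem)
  have "v - green n v n \<in> op_kernel (proj n)"
    using backward_in_kernel[of n n v] by (simp add: backward_def)
  from step_kernel[OF this]
  have "blinfun_apply (proj (n + 1)) (blinfun_apply (A n) v)
    = blinfun_apply (proj (n + 1)) (blinfun_apply (A n) (green n v n))"
    by (simp add: op_kernel_def blinfun.diff_right)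
  with 1 show "blinfun_apply (A n o\<^sub>L proj n) v = blinfun_apply (proj (n + 1) o\<^sub>L A n) v"
    by (simp add: proj_apply)
qed

text \<open>If \<open>A n\<close> identifies two kernel vectors, their difference followed by zeros
  is a bounded forward trajectory, so \<open>proj n\<close> both fixes and annihilates it. A
  preimage of \<open>w\<close> is the value at \<open>n\<close> of the backward trajectory through
  \<open>w\<close>.\<close>

lemma bij_betw_kernel: "bij_betw (blinfun_apply (A n)) (op_kernel (proj n)) (op_kernel (proj (n + 1)))"
proof (rule bij_betw_imageI)
  show "inj_on (blinfun_apply (A n)) (op_kernel (proj n))"
  proof (rule inj_onI)
    fix v w
    assume vw: "v \<in> op_kernel (proj n)" "w \<in> op_kernel (proj n)"
      and eq: "blinfun_apply (A n) v = blinfun_apply (A n) w"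
    define u where "u m = (if m = n then v - w else 0)" for m
    have "u (m + 1) = blinfun_apply (A m) (u m)" if "n \<le> m" for m
      using eq that by (auto simp: u_def blinfun.diff_right)
    then have "blinfun_apply (proj n) (u n) = u n"
      by (rule proj_forward[of _ _ "norm (v - w)"]) (auto simp: u_def)
    with vw show "v = w" by (simp add: u_def op_kernel_def blinfun.diff_right)
  qed
  show "blinfun_apply (A n) ` op_kernel (proj n) = op_kernel (proj (n + 1))"
  proof (intro equalityI image_subsetI subsetI step_kernel)
    fix w assume w: "w \<in> op_kernel (proj (n + 1))"
    then have "w = blinfun_apply (A n) (backward (n + 1) w n)"
      using backward_step[of n "n + 1" w] by (simp add: kernel_backward)
    then show "w \<in> blinfun_apply (A n) ` op_kernel (proj n)"
      using backward_in_kernel[of n "n + 1" w] by auto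
  qed
qed

text \<open>Evolving \<open>proj n\<close> of \<open>v\<close> forward gives the response after
  \<open>n\<close>, and evolving the complementary part backward gives minus the response before
  \<open>n\<close>. Both dichotomy bounds are thus the decay of \<open>green n v\<close>, with rate
  \<open>ln r\<close>.\<close>

lemma exponential_dichotomy:
  assumes s: "normed_vector_space s" and A: "\<And>n. A n \<in> bounded_ops s s"
  shows "exponential_dichotomy s A"
proof -
  interpret normed_vector_space s by fact
  obtain C r where C: "C > 0" and r: "r > 1"
    and decay: "\<forall>n v m. norm (green n v m) * r ^ nat \<bar>m - n\<bar> \<le> C * norm v"
    by (rule green_decay)
  define \<alpha> where "\<alpha> = ln r"
  have \<alpha>: "\<alpha> > 0" using r by (simp add: \<alpha>_def)
  have exp_eq: "exp (- \<alpha> * of_int k) = 1 / r ^ nat k" if "k \<ge> 0" for k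
  proof -
    have "exp (- \<alpha> * of_int k) = exp (real (nat k) * - \<alpha>)" using that by simp
    also have "\<dots> = (1 / r) ^ nat k"
      using r by (simp only: exp_of_nat_mult) (simp add: \<alpha>_def exp_minus inverse_eq_divide)
    finally show ?thesis by (simp add: power_one_over)
  qed
  have decay': "norm (green n v m) \<le> C * exp (- \<alpha> * of_int \<bar>m - n\<bar>) * norm v" for n v m
    using decay[rule_format, of n v m] r unfolding exp_eq[OF abs_ge_zero] by (simp add: pos_le_divide_eq)
  have scaling: "blinfun_apply (A n) (s c x) = s c (blinfun_apply (A n) x)" for n c x
    using A[of n] by (simp add: bounded_ops_def Vector_Spaces.linear_iff)
  have "proj n \<in> bounded_ops s s" for n
    unfolding bounded_ops_def Vector_Spaces.linear_iff
    using vector_space_axioms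
    by (simp add: blinfun.add_right proj_apply green_scale[OF s scaling])
  moreover have "proj n o\<^sub>L proj n = proj n" for n
    by (rule blinfun_eqI) (simp add: proj_idem[unfolded proj_apply] proj_apply)
  moreover have "norm (evol A m n o\<^sub>L proj n) \<le> (C + 1) * exp (- \<alpha> * of_int (m - n))" if "n \<le> m" for m n
  proof (rule norm_blinfun_bound)
    fix v
    have "blinfun_apply (evol A m n o\<^sub>L proj n) v = green n v m"
      using evol_trajectory[OF that, of "green n v" A] by (simp add: proj_apply green_step)
    also have "norm \<dots> \<le> C * exp (- \<alpha> * of_int (m - n)) * norm v"
      using decay'[of n v m] that by simp
    also have "\<dots> \<le> (C + 1) * exp (- \<alpha> * of_int (m - n)) * norm v"
      by (intro mult_right_mono) auto
    finally show "norm (blinfun_apply (evol A m n o\<^sub>L proj n) v) \<le> \<dots>" .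
  qed (use C in simp)
  moreover have "norm (back_evol A proj m n (v - blinfun_apply (proj n) v))
      \<le> (C + 1) * exp (- \<alpha> * of_int (n - m)) * norm v" if "m \<le> n" for m n v
  proof -
    have "back_evol A proj m n (v - blinfun_apply (proj n) v) = backward n v m"
    proof (rule back_evol_unique[OF that bij_betw_kernel backward_in_kernel[OF that]])
      have "blinfun_apply (evol A n m) (backward n v m) = backward n v n"
        using that by (intro evol_trajectory) (auto simp: backward_step)
      then show "blinfun_apply (evol A n m) (backward n v m) = v - blinfun_apply (proj n) v"
        by (simp add: backward_def proj_apply)
    qed
    also have "norm \<dots> \<le> (C + 1) * exp (- \<alpha> * of_int (n - m)) * norm v"
    proof (cases "m = n")
      \<comment> \<open>Here \<open>backward\<close> contains \<open>v\<close> itself besides the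
        response, whence the constant \<open>C + 1\<close>.\<close>
      case True
      then show ?thesis
        using decay'[of n v n] norm_triangle_ineq4[of v "green n v n"] by (simp add: backward_def algebra_simps)
    next
      case False
      then have "norm (backward n v m) \<le> C * exp (- \<alpha> * of_int (n - m)) * norm v"
        using decay'[of n v m] that by (simp add: backward_def)
      also have "\<dots> \<le> (C + 1) * exp (- \<alpha> * of_int (n - m)) * norm v"
        by (intro mult_right_mono) auto
      finally show ?thesis .
    qed
    finally show ?thesis .
  qed
  ultimately show ?thesis
    unfolding exponential_dichotomy_def
    using C \<alpha> proj_commute bij_betw_kernel
    by (intro exI[of _ proj] exI[of _ "C + 1"] exI[of _ \<alpha>]) auto
qed

end

section \<open>Block systems\<close>

lemma normed_vector_space_prod:
  assumes "normed_vector_space s1" "normed_vector_space s2"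
  shows "normed_vector_space (module_prod.scale s1 s2)"
proof -
  interpret v1: normed_vector_space s1 by fact
  interpret v2: normed_vector_space s2 by fact
  interpret vector_space_prod s1 s2 by unfold_locales
  show ?thesis
  proof
    show "scale (of_real r) x = r *\<^sub>R x" for r x
      by (cases x) (simp add: scale_prod v1.scale_of_real v2.scale_of_real)
    show "norm (scale c x) = norm c * norm x" for c x
      by (simp add: scale_def norm_prod_def v1.norm_scale v2.norm_scale power_mult_distrib
          real_sqrt_mult flip: distrib_left)
  qed
qed

lemma block_diag_in_bounded_ops:
  assumes "T1 \<in> bounded_ops s1 s1" and "T2 \<in> bounded_ops s2 s2"
  shows "block_op T1 0 0 T2 \<in> bounded_ops (module_prod.scale s1 s2) (module_prod.scale s1 s2)"
proof -
  have lin: "Vector_Spaces.linear s1 s1 (blinfun_apply T1)" "Vector_Spaces.linear s2 s2 (blinfun_apply T2)"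
    using assms by (simp_all add: bounded_ops_def)
  then interpret v1: vector_space s1 + v2: vector_space s2
    by (simp_all add: Vector_Spaces.linear_iff)
  interpret vector_space_prod s1 s2 by unfold_locales
  show ?thesis
    using lin p.vector_space_axioms
    by (simp add: bounded_ops_def Vector_Spaces.linear_iff block_op.rep_eq blinfun.add_right scale_def)
qed

text \<open>The coupling is read as an extra forcing of the first component; the index
  \<open>n - 1\<close> again comes from indexing forcings by arrival time.\<close>

lemma solves_forced_block:
  "solves_forced (\<lambda>n. block_op (A11 n) (A12 n) 0 (A22 n)) f x \<longleftrightarrow>
    solves_forced A11 (\<lambda>n. blinfun_apply (A12 (n - 1)) (snd (x (n - 1))) + fst (f n)) (\<lambda>n. fst (x n)) \<and>
    solves_forced A22 (\<lambda>n. snd (f n)) (\<lambda>n. snd (x n))"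
  by (auto simp: solves_forced_def block_op.rep_eq prod_eq_iff add.assoc)

lemma is_solution_block:
  "is_solution (\<lambda>n. block_op (A11 n) (A12 n) 0 (A22 n)) x \<longleftrightarrow>
    (\<forall>n. fst (x (n + 1)) = blinfun_apply (A11 n) (fst (x n)) + blinfun_apply (A12 n) (snd (x n))) \<and>
    is_solution A22 (\<lambda>n. snd (x n))"
  by (auto simp: is_solution_def block_op.rep_eq prod_eq_iff)

lemma bounded_range_prod_iff:
  "bounded (range x) \<longleftrightarrow> bounded (range (\<lambda>n. fst (x n))) \<and> bounded (range (\<lambda>n. snd (x n)))"
proof
  assume "bounded (range x)"
  then have "bounded (fst ` range x)" "bounded (snd ` range x)"
    by (rule bounded_fst bounded_snd)+
  then show "bounded (range (\<lambda>n. fst (x n))) \<and> bounded (range (\<lambda>n. snd (x n)))"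
    by (simp add: image_image)
next
  assume "bounded (range (\<lambda>n. fst (x n))) \<and> bounded (range (\<lambda>n. snd (x n)))"
  then have "bounded (range (\<lambda>n. fst (x n)) \<times> range (\<lambda>n. snd (x n)))"
    by (simp add: bounded_Times)
  moreover have "x n \<in> range (\<lambda>n. fst (x n)) \<times> range (\<lambda>n. snd (x n))" for n
    by (simp add: mem_Times_iff)
  then have "range x \<subseteq> range (\<lambda>n. fst (x n)) \<times> range (\<lambda>n. snd (x n))"
    by blast
  ultimately show "bounded (range x)" by (rule bounded_subset)
qed

text \<open>The forcing is split by components. The triangular response to the first part has zero
  second component, hence no coupling; from the response to the second part only the second
  component is kept, which evolves independently of the first.\<close>

lemma admissible_block_diag:
  assumes tri: "admissible (\<lambda>n. block_op (A11 n) (A12 n) 0 (A22 n))"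
    and null: "\<not> (\<exists>x. is_solution A22 x \<and> bounded (range x) \<and> x \<noteq> (\<lambda>n. 0))"
  shows "admissible (\<lambda>n. block_op (A11 n) 0 0 (A22 n))"
  unfolding admissible_def
proof (intro conjI allI impI)
  fix f :: "int \<Rightarrow> 'a \<times> 'b"
  assume "bounded (range f)"
  then have f: "bounded (range (\<lambda>n. (fst (f n), 0 :: 'b)))" "bounded (range (\<lambda>n. (0 :: 'a, snd (f n))))"
    by (simp_all add: bounded_range_prod_iff image_constant_conv)
  obtain y where y: "bounded (range y)"
    "solves_forced (\<lambda>n. block_op (A11 n) (A12 n) 0 (A22 n)) (\<lambda>n. (fst (f n), 0)) y"
    using tri f(1) unfolding admissible_def by blast
  obtain z where z: "bounded (range z)"
    "solves_forced (\<lambda>n. block_op (A11 n) (A12 n) 0 (A22 n)) (\<lambda>n. (0, snd (f n))) z"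
    using tri f(2) unfolding admissible_def by blast
  have "is_solution A22 (\<lambda>n. snd (y n))"
    using y(2) by (simp add: solves_forced_block) (simp add: solves_forced_def is_solution_def)
  then have "(\<lambda>n. snd (y n)) = (\<lambda>n. 0)"
    using null y(1) by (auto simp: bounded_range_prod_iff)
  then have y0: "snd (y n) = 0" for n by (simp add: fun_eq_iff)
  have "bounded (range (\<lambda>n. (fst (y n), snd (z n))))"
    using y(1) z(1) by (simp add: bounded_range_prod_iff)
  moreover have "solves_forced (\<lambda>n. block_op (A11 n) 0 0 (A22 n)) f (\<lambda>n. (fst (y n), snd (z n)))"
    using y(2) z(2) by (simp add: solves_forced_block y0)
  ultimately show "\<exists>x. bounded (range x) \<and> solves_forced (\<lambda>n. block_op (A11 n) 0 0 (A22 n)) f x"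
    by blast
next
  fix x :: "int \<Rightarrow> 'a \<times> 'b"
  assume bdd: "bounded (range x)" and sol: "is_solution (\<lambda>n. block_op (A11 n) 0 0 (A22 n)) x"
  then have "(\<lambda>n. snd (x n)) = (\<lambda>n. 0)"
    using null by (auto simp: is_solution_block bounded_range_prod_iff)
  then have "snd (x n) = 0" for n by (simp add: fun_eq_iff)
  \<comment> \<open>With zero second component the diagonal and triangular equations agree, so
    uniqueness transfers.\<close>
  then have "is_solution (\<lambda>n. block_op (A11 n) (A12 n) 0 (A22 n)) x"
    using sol by (simp add: is_solution_block)
  with bdd tri show "x = (\<lambda>n. 0)" unfolding admissible_def by blast
qed

theorem theorem6:
  fixes s1 :: "'k::real_normed_field \<Rightarrow> 'a::{real_inner, banach} \<Rightarrow> 'a"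
    and s2 :: "'k \<Rightarrow> 'b::{real_inner, banach} \<Rightarrow> 'b"
    and A11 :: "int \<Rightarrow> 'a \<Rightarrow>\<^sub>L 'a"
    and A12 :: "int \<Rightarrow> 'b \<Rightarrow>\<^sub>L 'a"
    and A22 :: "int \<Rightarrow> 'b \<Rightarrow>\<^sub>L 'b"
  assumes "normed_vector_space s1" and "normed_vector_space s2"
    and "\<And>n. A11 n \<in> bounded_ops s1 s1"
    and "\<And>n. A12 n \<in> bounded_ops s2 s1"
    and "\<And>n. A22 n \<in> bounded_ops s2 s2"
    and "exponential_dichotomy (module_prod.scale s1 s2)
           (\<lambda>n. block_op (A11 n) (A12 n) 0 (A22 n))"
  shows "exponential_dichotomy (module_prod.scale s1 s2)
           (\<lambda>n. block_op (A11 n) 0 0 (A22 n))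
         \<longleftrightarrow> \<not> (\<exists>x. is_solution A22 x \<and> bounded (range x) \<and> x \<noteq> (\<lambda>n. 0))"
proof
  assume "exponential_dichotomy (module_prod.scale s1 s2) (\<lambda>n. block_op (A11 n) 0 0 (A22 n))"
  then have adm: "admissible (\<lambda>n. block_op (A11 n) 0 0 (A22 n))"
    by (rule dichotomy_imp_admissible)
  show "\<not> (\<exists>x. is_solution A22 x \<and> bounded (range x) \<and> x \<noteq> (\<lambda>n. 0))"
  proof clarify
    fix x
    assume sol: "is_solution A22 x" and bdd: "bounded (range x)" and "x \<noteq> (\<lambda>n. 0)"
    \<comment> \<open>In the diagonal system a bounded solution of the second block extends by zero,
      contradicting uniqueness.\<close>
    have "is_solution (\<lambda>n. block_op (A11 n) 0 0 (A22 n)) (\<lambda>n. (0, x n))"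
      using sol by (simp add: is_solution_block)
    moreover have "bounded (range (\<lambda>n. (0 :: 'a, x n)))"
      using bdd by (simp add: bounded_range_prod_iff image_constant_conv)
    ultimately have "(\<lambda>n. (0 :: 'a, x n)) = (\<lambda>n. 0)"
      using adm unfolding admissible_def by blast
    then have "x = (\<lambda>n. 0)" by (simp add: fun_eq_iff zero_prod_def)
    with \<open>x \<noteq> (\<lambda>n. 0)\<close> show False ..
  qed
next
  assume "\<not> (\<exists>x. is_solution A22 x \<and> bounded (range x) \<and> x \<noteq> (\<lambda>n. 0))"
  then interpret admissible_system "\<lambda>n. block_op (A11 n) 0 0 (A22 n)"
    by unfold_locales (rule admissible_block_diag[OF dichotomy_imp_admissible[OF assms(6)]])
  show "exponential_dichotomy (module_prod.scale s1 s2) (\<lambda>n. block_op (A11 n) 0 0 (A22 n))"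
    by (intro exponential_dichotomy normed_vector_space_prod block_diag_in_bounded_ops assms(1,2,3,5))
qed

end
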